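(* Let $S$ be a set of positive rationals and let $Q$ be a property that a finite set of distinct positive integers may or may not have. Assume that for every $\alpha\in S$ there are a positive integer $l$, positive integers $m_1,\ldots,m_l$, rationals $\beta_1,\ldots,\beta_l$ and finite sets of positive integers $A_1,\ldots,A_l$ (all depending on $\alpha$), with $A_i$ non-empty whenever $m_i=1$, satisfying the following five properties: 1. For all $i$, $\beta_i\in S$. 2. For every positive integer $n$ there exists an $i$ with $n\equiv \sum A_i \pmod{m_i}$. 3. For all $i$, $\alpha=\sum A_i^{-1}+\frac{\beta_i}{m_i}$. 4. For all $i$ and every $\beta_i$-partition $B$ with property $Q$, we have $A_i\cap m_iB=\emptyset$. 5. For all $i$ and every $\beta_i$-partition $B$ with property $Q$, the union $A_i\cup m_iB$ also has property $Q$. Further assume that there is a positive integer $X$ such that for all $\alpha\in S$ and all integers $n$ with $X\le n\le \max_{i,\alpha}\big(\sum A_i+m_i(X-1)\big)$, where the maximum is over all $\alpha\in S$ and all indices $i$ in the data chosen for that $\alpha$, an $\alpha$-partition of $n$ with property $Q$ exists. Then for all $\alpha\in S$ and all integers $n\ge X$ an $\alpha$-partition of $n$ with property $Q$ exists.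
   Context: For a positive rational $\alpha$ and a positive integer $n$, an $\alpha$-partition of $n$ is a finite set $\{a_1,\ldots,a_r\}$ of distinct positive integers with $a_1+\cdots+a_r=n$ and $\frac1{a_1}+\cdots+\frac1{a_r}=\alpha$; an $\alpha$-partition is an $\alpha$-partition of some positive integer $n$. For a finite set $A=\{a_1,\ldots,a_r\}$ of positive integers and a positive integer $m$, $\sum A$ denotes $a_1+\cdots+a_r$, $\sum A^{-1}$ denotes $\frac1{a_1}+\cdots+\frac1{a_r}$, and $mA=\{ma_1,\ldots,ma_r\}$ (sums over the empty set are $0$). *)

theory Defs
  imports
    Complex_Main
    "HOL-Number_Theory.Cong"
    "HOL-Library.Extended_Nat"
begin

(* Extended_Nat is needed for the maximum over all members of a possibly infinite set S: it is
   taken as a supremum in enat, which equals the maximum whenever that exists. *)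

definition recip_sum :: "nat set \<Rightarrow> rat" where
  "recip_sum A = (\<Sum>a\<in>A. 1 / of_nat a)"

definition pos_finite :: "nat set \<Rightarrow> bool" where
  "pos_finite A \<longleftrightarrow> finite A \<and> (\<forall>a\<in>A. 0 < a)"

(* The positivity of \<alpha> and n is not part of this predicate; wherever it is used, it follows from
   the range of \<alpha> and n. *)
definition partition_of :: "rat \<Rightarrow> nat \<Rightarrow> nat set \<Rightarrow> bool" where
  "partition_of \<alpha> n A \<longleftrightarrow> pos_finite A \<and> \<Sum>A = n \<and> recip_sum A = \<alpha>"

definition is_partition :: "rat \<Rightarrow> nat set \<Rightarrow> bool" where
  "is_partition \<alpha> A \<longleftrightarrow> (\<exists>n>0. partition_of \<alpha> n A)"

definition dilate :: "nat \<Rightarrow> nat set \<Rightarrow> nat set" where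
  "dilate m A = (\<lambda>a. m * a) ` A"

end

theory Submission imports Defs begin

text \<open>
  The proof is a strong induction on \<open>n\<close>, for all \<open>\<alpha> \<in> S\<close> at once. If \<open>n\<close> is at most the
  supremum of the numbers \<open>\<Sum>A\<^sub>i + m\<^sub>i (X - 1)\<close>, the initial assumption applies. Otherwise choose \<open>i\<close>
  with \<open>n \<equiv> \<Sum>A\<^sub>i\<close> modulo \<open>m\<^sub>i\<close>. Since \<open>n\<close> exceeds \<open>\<Sum>A\<^sub>i + m\<^sub>i (X - 1)\<close>, it has the form
  \<open>n = \<Sum>A\<^sub>i + m\<^sub>i k\<close> with \<open>k \<ge> X\<close> (lemma \<open>cong_large_quotient\<close>). Moreover \<open>k < n\<close>, because
  either \<open>m\<^sub>i \<ge> 2\<close> or \<open>A\<^sub>i\<close> contributes a positive amount. The induction hypothesis therefore yields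
  a \<open>\<beta>\<^sub>i\<close>-partition \<open>B\<close> of \<open>k\<close> with property \<open>Q\<close>. Dilating by \<open>m\<^sub>i\<close> multiplies the sum by \<open>m\<^sub>i\<close> and
  divides the reciprocal sum by \<open>m\<^sub>i\<close>, so that the disjoint union of \<open>A\<^sub>i\<close> and \<open>m\<^sub>i B\<close> is an
  \<open>\<alpha>\<close>-partition of \<open>n\<close> (lemma \<open>partition_of_union_dilate\<close>).
\<close>

lemma sum_dilate:
  assumes "0 < m"
  shows "\<Sum>(dilate m B) = m * \<Sum>B"
proof -
  have "inj_on (\<lambda>a. m * a) B"
    using assms by (auto simp: inj_on_def)
  then show ?thesis
    unfolding dilate_def by (simp add: sum.reindex sum_distrib_left)
qed

lemma recip_sum_dilate:
  assumes "0 < m"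
  shows "recip_sum (dilate m B) = recip_sum B / of_nat m"
proof -
  have "inj_on (\<lambda>a. m * a) B"
    using assms by (auto simp: inj_on_def)
  then show ?thesis
    unfolding recip_sum_def dilate_def
    by (simp add: sum.reindex sum_divide_distrib mult.commute)
qed

lemma pos_finite_dilate:
  assumes "0 < m" "pos_finite B"
  shows "pos_finite (dilate m B)"
  using assms by (auto simp: pos_finite_def dilate_def)

lemma pos_finite_sum_pos:
  assumes "pos_finite A" "A \<noteq> {}"
  shows "0 < \<Sum>A"
  using assms unfolding pos_finite_def by (intro sum_pos) auto

lemma partition_of_union_dilate:
  assumes "pos_finite A" "0 < m" "partition_of \<beta> k B" "A \<inter> dilate m B = {}"
  shows "partition_of (recip_sum A + \<beta> / of_nat m) (\<Sum>A + m * k) (A \<union> dilate m B)"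
proof -
  have B: "pos_finite B" "\<Sum>B = k" "recip_sum B = \<beta>"
    using assms(3) by (auto simp: partition_of_def)
  have D: "pos_finite (dilate m B)"
    using pos_finite_dilate assms(2) B(1) .
  have fin: "finite A" "finite (dilate m B)"
    using assms(1) D by (auto simp: pos_finite_def)
  have "pos_finite (A \<union> dilate m B)"
    using assms(1) D by (auto simp: pos_finite_def)
  moreover have "\<Sum>(A \<union> dilate m B) = \<Sum>A + m * k"
    using sum.union_disjoint[OF fin assms(4)] sum_dilate[OF assms(2)] B(2) by metis
  moreover have "recip_sum (A \<union> dilate m B) = recip_sum A + recip_sum (dilate m B)"
    unfolding recip_sum_def by (rule sum.union_disjoint[OF fin assms(4)])
  ultimately show ?thesis
    using recip_sum_dilate[OF assms(2)] B(3) by (simp add: partition_of_def)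
qed

text \<open>
  The bound on \<open>n\<close> forces the quotient of \<open>n - s\<close> by \<open>m\<close> above \<open>X - 1\<close>: the descent from \<open>n\<close> to
  this quotient stays in the range \<open>{X..}\<close> that the induction covers.
\<close>

lemma cong_large_quotient:
  fixes n s m X :: nat
  assumes "[n = s] (mod m)" "s + m * (X - 1) < n"
  obtains k where "n = s + m * k" "X \<le> k"
proof -
  have "s \<le> n"
    using assms(2) by simp
  then have "m dvd n - s"
    using assms(1) by (simp add: cong_altdef_nat)
  then obtain k where k: "n - s = m * k" ..
  have n: "n = s + m * k"
    using k \<open>s \<le> n\<close> by simp
  then have "m * (X - 1) < m * k"
    using assms(2) by simp
  then have "X - 1 < k"
    by simp
  then have "X \<le> k"
    by linarith
  with n show thesis
    using that by blast
qed

theorem theorem2: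
  fixes S :: "rat set"
    and Q :: "nat set \<Rightarrow> bool"
    and l :: "rat \<Rightarrow> nat"
    and m :: "rat \<Rightarrow> nat \<Rightarrow> nat"
    and \<beta> :: "rat \<Rightarrow> nat \<Rightarrow> rat"
    and A :: "rat \<Rightarrow> nat \<Rightarrow> nat set"
    and X :: nat
  assumes S_pos: "\<And>\<alpha>. \<alpha> \<in> S \<Longrightarrow> 0 < \<alpha>"
    and l_pos: "\<And>\<alpha>. \<alpha> \<in> S \<Longrightarrow> 0 < l \<alpha>"
    and m_pos: "\<And>\<alpha> i. \<alpha> \<in> S \<Longrightarrow> i \<in> {1..l \<alpha>} \<Longrightarrow> 0 < m \<alpha> i"
    and A_pos_finite: "\<And>\<alpha> i. \<alpha> \<in> S \<Longrightarrow> i \<in> {1..l \<alpha>} \<Longrightarrow> pos_finite (A \<alpha> i)"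
    and A_nonempty: "\<And>\<alpha> i. \<alpha> \<in> S \<Longrightarrow> i \<in> {1..l \<alpha>} \<Longrightarrow> m \<alpha> i = 1 \<Longrightarrow> A \<alpha> i \<noteq> {}"
    and prop1: "\<And>\<alpha> i. \<alpha> \<in> S \<Longrightarrow> i \<in> {1..l \<alpha>} \<Longrightarrow> \<beta> \<alpha> i \<in> S"
    and prop2: "\<And>\<alpha> n. \<alpha> \<in> S \<Longrightarrow> 0 < n \<Longrightarrow> \<exists>i\<in>{1..l \<alpha>}. [n = \<Sum>(A \<alpha> i)] (mod m \<alpha> i)"
    and prop3: "\<And>\<alpha> i. \<alpha> \<in> S \<Longrightarrow> i \<in> {1..l \<alpha>} \<Longrightarrow>
      \<alpha> = recip_sum (A \<alpha> i) + \<beta> \<alpha> i / of_nat (m \<alpha> i)"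
    and prop4: "\<And>\<alpha> i B. \<alpha> \<in> S \<Longrightarrow> i \<in> {1..l \<alpha>} \<Longrightarrow> is_partition (\<beta> \<alpha> i) B \<Longrightarrow> Q B \<Longrightarrow>
      A \<alpha> i \<inter> dilate (m \<alpha> i) B = {}"
    and prop5: "\<And>\<alpha> i B. \<alpha> \<in> S \<Longrightarrow> i \<in> {1..l \<alpha>} \<Longrightarrow> is_partition (\<beta> \<alpha> i) B \<Longrightarrow> Q B \<Longrightarrow>
      Q (A \<alpha> i \<union> dilate (m \<alpha> i) B)"
    and X_pos: "0 < X"
    and initial: "\<And>\<alpha> n. \<alpha> \<in> S \<Longrightarrow> X \<le> n \<Longrightarrow>
      enat n \<le> (SUP \<alpha>'\<in>S. SUP i\<in>{1..l \<alpha>'}. enat (\<Sum>(A \<alpha>' i) + m \<alpha>' i * (X - 1))) \<Longrightarrow>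
      \<exists>B. partition_of \<alpha> n B \<and> Q B"
  shows "\<forall>\<alpha>\<in>S. \<forall>n\<ge>X. \<exists>B. partition_of \<alpha> n B \<and> Q B"
proof -
  have "\<exists>B. partition_of \<alpha> n B \<and> Q B" if "\<alpha> \<in> S" "X \<le> n" for \<alpha> n
    using that
  proof (induction n arbitrary: \<alpha> rule: less_induct)
    case (less n)
    let ?bound = "SUP \<alpha>'\<in>S. SUP i\<in>{1..l \<alpha>'}. enat (\<Sum>(A \<alpha>' i) + m \<alpha>' i * (X - 1))"
    show ?case
    proof (cases "enat n \<le> ?bound")
      case True
      then show ?thesis
        using initial less.prems by blast
    next
      case False
      obtain i where i: "i \<in> {1..l \<alpha>}" "[n = \<Sum>(A \<alpha> i)] (mod m \<alpha> i)"
        using prop2[of \<alpha> n] less.prems X_pos by auto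
      have "enat (\<Sum>(A \<alpha> i) + m \<alpha> i * (X - 1)) \<le> ?bound"
        using less.prems(1) i(1) by (intro SUP_upper2[of \<alpha>] SUP_upper)
      also have "?bound < enat n"
        using False by simp
      finally have "\<Sum>(A \<alpha> i) + m \<alpha> i * (X - 1) < n"
        by simp
      then obtain k where k: "n = \<Sum>(A \<alpha> i) + m \<alpha> i * k" "X \<le> k"
        using cong_large_quotient i(2) by blast
      have m: "0 < m \<alpha> i"
        using m_pos less.prems(1) i(1) .
      have Ai: "pos_finite (A \<alpha> i)"
        using A_pos_finite less.prems(1) i(1) .
      have "0 < k"
        using k(2) X_pos by simp
      have "k < n"
      proof (cases "m \<alpha> i = 1")
        case True
        then have "0 < \<Sum>(A \<alpha> i)"
          using A_nonempty less.prems(1) i(1) Ai pos_finite_sum_pos by blast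
        then show ?thesis
          using k(1) True by simp
      next
        case False
        then have "1 * k < m \<alpha> i * k"
          using m \<open>0 < k\<close> by (intro mult_strict_right_mono) auto
        then show ?thesis
          using k(1) by linarith
      qed
      then obtain B where B: "partition_of (\<beta> \<alpha> i) k B" "Q B"
        using less.IH prop1 less.prems(1) i(1) k(2) by blast
      have isB: "is_partition (\<beta> \<alpha> i) B"
        using B(1) \<open>0 < k\<close> by (auto simp: is_partition_def)
      have "A \<alpha> i \<inter> dilate (m \<alpha> i) B = {}"
        using prop4 less.prems(1) i(1) isB B(2) .
      then have "partition_of \<alpha> n (A \<alpha> i \<union> dilate (m \<alpha> i) B)"
        using partition_of_union_dilate[OF Ai m B(1)] prop3[OF less.prems(1) i(1)] k(1) by simp
      moreover have "Q (A \<alpha> i \<union> dilate (m \<alpha> i) B)"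
        using prop5 less.prems(1) i(1) isB B(2) .
      ultimately show ?thesis
        by blast
    qed
  qed
  then show ?thesis
    by blast
qed

end
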